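(* Let $(\mathcal{R},\oplus,\leqslant)$ be a lattice ordered monoid with neutral element $0$ whose lattice is conditionally complete, let $D=(V,A)$ be a finite digraph, $d\in V$, and $(x_a)_{a\in A}\in\mathcal{R}^A$. Let $b_v^n$, $b_v^\infty$, $b_v^\dagger$ and $b_v^{\mathrm{opt}}$ be the elements of $\mathcal{R}\cup\{-\infty,+\infty\}$ defined in the context. Suppose that $x_C\geqslant 0$ for each cycle $C$ in $D$. Then for each vertex $v$ and each $v$-$d$ path $P$, denoting by $\ell^*$ the length (number of arcs) of the longest elementary $v$-$d$ path, $$b_v^\dagger\leqslant b_v^\infty\leqslant b_v^{\ell^*}\leqslant b_v^{\mathrm{opt}}\leqslant x_P .$$ If moreover $\oplus$ distributes with respect to the meet $\wedge$, then the first three inequalities are equalities.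
   Context: A lattice ordered monoid $(\mathcal{R},\oplus,\leqslant)$ is a monoid $(\mathcal{R},\oplus)$ (associative, with neutral element $0$, possibly non-commutative) with a partial order $\leqslant$ that is a lattice order and is such that all translations $y\mapsto x\oplus y$ and $y\mapsto y\oplus x$ are isotone. Conditionally complete: every nonempty bounded subset has a meet and a join. $\mathcal{R}$ is completed into the complete lattice $\mathcal{R}\cup\{-\infty,+\infty\}$, with $-\infty$ (resp. $+\infty$) smaller (resp. greater) than every element of $\mathcal{R}$, and $x\oplus(\pm\infty)=\pm\infty$ for $x\in\mathcal{R}$. $\wedge$ denotes the meet; the meet of the empty set is $+\infty$. $\oplus$ distributes with respect to $\wedge$ if $a\oplus(b\wedge c)=(a\oplus b)\wedge(a\oplus c)$ and $(a\wedge b)\oplus c=(a\oplus c)\wedge(b\oplus c)$ for all $a,b,c\in\mathcal{R}$. Paths are finite sequences of arcs, the head of each being the tail of the next; vertices and arcs may be repeated, and the empty path at each vertex (with resource $0$) is allowed. A path is elementary if it contains each vertex at most once. A cycle is a nonempty path whose origin equals its destination. The resource of $P=(a_1,\dots,a_k)$ is $x_P=x_{a_1}\oplus\cdots\oplus x_{a_k}$. $\delta^+(v)$ is the set of arcs outgoing from $v$, and $\mathcal{P}_{vd}$ is the set of $v$-$d$ paths. Definitions: $b_d^n=0$ for all $n\in\mathbb{Z}_+$; for $v\in V\setminus\{d\}$, $b_v^0=+\infty$ and $b_v^{n+1}=b_v^n\wedge\bigwedge_{(v,u)\in\delta^+(v)}(x_{(v,u)}\oplus b_u^n)$. $b_v^\infty=\bigwedge_{n\in\mathbb{Z}_+}b_v^n$.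 $b_v^{\mathrm{opt}}=\bigwedge_{P\in\mathcal{P}_{vd}}x_P$. $(b_v^\dagger)_{v\in V}$ is the greatest solution (for the product order) in $(\mathcal{R}\cup\{-\infty,+\infty\})^V$ of the system $b_d=0$ and $b_v=b_v\wedge\bigwedge_{(v,u)\in\delta^+(v)}(x_{(v,u)}\oplus b_u)$ for all $v\in V\setminus\{d\}$. *)

theory Defs
  imports "Graph_Theory.Graph_Theory" "HOL-Library.Extended"
begin

class lattice_ordered_monoid = monoid_add + lattice +
  assumes add_isotone_left: "y \<le> z \<Longrightarrow> x + y \<le> x + z"
    and add_isotone_right: "y \<le> z \<Longrightarrow> y + x \<le> z + x"

text \<open>
  The type \<^typ>\<open>'r extended\<close> adjoins a least element \<^const>\<open>Minf\<close> and a greatest element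
  \<^const>\<open>Pinf\<close> to \<^typ>\<open>'r\<close>.
  The sum of two infinite values, and of an infinite left and a finite right summand, is also
  fixed by the library, but is never used below: all left summands are of the form \<open>Fin r\<close>.
\<close>

instantiation extended :: (conditionally_complete_lattice) complete_lattice
begin

definition "Inf_extended (X :: 'a extended set) =
  (if Minf \<in> X \<or> \<not> bdd_below (Fin -` X) then Minf
   else if Fin -` X = {} then Pinf
   else Fin (Inf (Fin -` X)))"

definition "Sup_extended (X :: 'a extended set) =
  (if Pinf \<in> X \<or> \<not> bdd_above (Fin -` X) then Pinf
   else if Fin -` X = {} then Minf
   else Fin (Sup (Fin -` X)))"

instance
proof
  fix x z :: "'a extended" and X :: "'a extended set"
  show "Inf X \<le> x" if "x \<in> X"
    using that by (cases x) (auto simp: Inf_extended_def intro: cInf_lower)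
  show "z \<le> Inf X" if le: "\<And>y. y \<in> X \<Longrightarrow> z \<le> y"
  proof (cases z)
    case (Fin r)
    then have r: "\<And>s. s \<in> Fin -` X \<Longrightarrow> r \<le> s" and "Minf \<notin> X"
      using le by force+
    moreover have "bdd_below (Fin -` X)"
      using r by (rule bdd_belowI)
    ultimately show ?thesis
      using Fin by (auto simp: Inf_extended_def intro: cInf_greatest)
  next
    case Pinf
    then have "Minf \<notin> X" "Fin -` X = {}"
      using le by force+
    then show ?thesis
      by (simp add: Inf_extended_def)
  qed simp
  show "x \<le> Sup X" if "x \<in> X"
    using that by (cases x) (auto simp: Sup_extended_def intro: cSup_upper)
  show "Sup X \<le> z" if le: "\<And>y. y \<in> X \<Longrightarrow> y \<le> z"
  proof (cases z)
    case (Fin r)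
    then have r: "\<And>s. s \<in> Fin -` X \<Longrightarrow> s \<le> r" and "Pinf \<notin> X"
      using le by force+
    moreover have "bdd_above (Fin -` X)"
      using r by (rule bdd_aboveI)
    ultimately show ?thesis
      using Fin by (auto simp: Sup_extended_def intro: cSup_least)
  next
    case Minf
    then have "Pinf \<notin> X" "Fin -` X = {}"
      using le by force+
    then show ?thesis
      by (simp add: Sup_extended_def)
  qed simp
  show "Inf {} = (top :: 'a extended)" "Sup {} = (bot :: 'a extended)"
    by (simp_all add: Inf_extended_def Sup_extended_def top_extended_def bot_extended_def)
qed

end

definition path_resource :: "('e \<Rightarrow> 'r::monoid_add) \<Rightarrow> 'e awalk \<Rightarrow> 'r" where
  "path_resource x p = sum_list (map x p)"

definition arc_bound ::
  "('v, 'e) pre_digraph \<Rightarrow> ('e \<Rightarrow> 'r::{lattice_ordered_monoid, conditionally_complete_lattice})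
    \<Rightarrow> ('v \<Rightarrow> 'r extended) \<Rightarrow> 'v \<Rightarrow> 'r extended" where
  "arc_bound G x b v = (INF a \<in> out_arcs G v. Fin (x a) + b (head G a))"

primrec b_iter ::
  "('v, 'e) pre_digraph \<Rightarrow> ('e \<Rightarrow> 'r::{lattice_ordered_monoid, conditionally_complete_lattice})
    \<Rightarrow> 'v \<Rightarrow> nat \<Rightarrow> 'v \<Rightarrow> 'r extended" where
  "b_iter G x d 0 = (\<lambda>v. if v = d then 0 else Pinf)"
| "b_iter G x d (Suc n) =
    (\<lambda>v. if v = d then 0 else inf (b_iter G x d n v) (arc_bound G x (b_iter G x d n) v))"

definition b_infty ::
  "('v, 'e) pre_digraph \<Rightarrow> ('e \<Rightarrow> 'r::{lattice_ordered_monoid, conditionally_complete_lattice})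
    \<Rightarrow> 'v \<Rightarrow> 'v \<Rightarrow> 'r extended" where
  "b_infty G x d v = (INF n. b_iter G x d n v)"

definition b_opt ::
  "('v, 'e) pre_digraph \<Rightarrow> ('e \<Rightarrow> 'r::{lattice_ordered_monoid, conditionally_complete_lattice})
    \<Rightarrow> 'v \<Rightarrow> 'v \<Rightarrow> 'r extended" where
  "b_opt G x d v = (INF p \<in> {p. pre_digraph.awalk G v p d}. Fin (path_resource x p))"

definition is_bound_solution ::
  "('v, 'e) pre_digraph \<Rightarrow> ('e \<Rightarrow> 'r::{lattice_ordered_monoid, conditionally_complete_lattice})
    \<Rightarrow> 'v \<Rightarrow> ('v \<Rightarrow> 'r extended) \<Rightarrow> bool" where
  "is_bound_solution G x d b \<longleftrightarrow>
    b d = 0 \<and> (\<forall>v \<in> verts G - {d}. b v = inf (b v) (arc_bound G x b v))"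

text \<open>
  Families indexed by \<open>verts G\<close> are functions in \<^term>\<open>extensional (verts G)\<close>. These all agree
  outside \<open>verts G\<close>, so on them the pointwise order on functions is the product order over
  \<open>verts G\<close>.
\<close>

definition b_dagger ::
  "('v, 'e) pre_digraph \<Rightarrow> ('e \<Rightarrow> 'r::{lattice_ordered_monoid, conditionally_complete_lattice})
    \<Rightarrow> 'v \<Rightarrow> 'v \<Rightarrow> 'r extended" where
  "b_dagger G x d = (GREATEST b. b \<in> extensional (verts G) \<and> is_bound_solution G x d b)"

lemma arc_bound_mono:
  assumes "wf_digraph G" and "\<And>u. u \<in> verts G \<Longrightarrow> b u \<le> c u"
  shows "arc_bound G x b v \<le> arc_bound G x c v"
  unfolding arc_bound_def
proof (rule INF_superset_mono[OF subset_refl])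
  fix a assume "a \<in> out_arcs G v"
  then have "b (head G a) \<le> c (head G a)"
    using assms by (auto intro: wf_digraph.head_in_verts)
  then show "Fin (x a) + b (head G a) \<le> Fin (x a) + c (head G a)"
    by (cases "b (head G a)"; cases "c (head G a)") (auto intro: add_isotone_left)
qed

lemma b_dagger_greatest:
  assumes "fin_digraph G" and "d \<in> verts G"
  shows "is_bound_solution G x d (b_dagger G x d)"
    and "is_bound_solution G x d b \<Longrightarrow> v \<in> verts G \<Longrightarrow> b v \<le> b_dagger G x d v"
proof -
  have wf: "wf_digraph G"
    using assms(1) by (simp add: fin_digraph_def)
  define g where "g = restrict (\<lambda>v. SUP b \<in> Collect (is_bound_solution G x d). b v) (verts G)"
  have upper: "b v \<le> g v" if "is_bound_solution G x d b" "v \<in> verts G" for b v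
    using that by (auto simp: g_def intro: SUP_upper)
  have ne: "\<exists>b. is_bound_solution G x d b"
    by (rule exI[of _ "\<lambda>v. if v = d then 0 else Minf"])
      (auto simp: is_bound_solution_def bot_extended_def[symmetric])
  have "g d = (SUP b \<in> Collect (is_bound_solution G x d). 0)"
    using assms(2) by (auto simp: g_def is_bound_solution_def intro!: SUP_cong)
  then have gd: "g d = 0"
    using ne by auto
  have "g v \<le> arc_bound G x g v" if v: "v \<in> verts G - {d}" for v
  proof -
    have "b v \<le> arc_bound G x g v" if b: "is_bound_solution G x d b" for b
    proof -
      have "b v \<le> arc_bound G x b v"
        using b v by (metis is_bound_solution_def inf.cobounded2)
      also have "\<dots> \<le> arc_bound G x g v"
        using wf upper[OF b] by (rule arc_bound_mono)
      finally show ?thesis .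
    qed
    then show ?thesis
      using v by (auto simp: g_def intro: SUP_least)
  qed
  then have sol: "is_bound_solution G x d g"
    using gd by (simp add: is_bound_solution_def inf_absorb1)
  have "b_dagger G x d = g"
    unfolding b_dagger_def
  proof (rule Greatest_equality)
    show "g \<in> extensional (verts G) \<and> is_bound_solution G x d g"
      using sol by (simp add: g_def)
    show "b \<le> g" if "b \<in> extensional (verts G) \<and> is_bound_solution G x d b" for b
      using that upper by (auto simp: le_fun_def g_def extensional_def)
  qed
  then show "is_bound_solution G x d (b_dagger G x d)"
    and "is_bound_solution G x d b \<Longrightarrow> v \<in> verts G \<Longrightarrow> b v \<le> b_dagger G x d v"
    using sol upper by auto
qed

definition longest_elementary_length :: "('v, 'e) pre_digraph \<Rightarrow> 'v \<Rightarrow> 'v \<Rightarrow> nat" where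
  "longest_elementary_length G v d = Max (length ` {p. pre_digraph.apath G v p d})"

end

theory Submission
  imports Defs
begin

text \<open>
  A solution of the system lies below every iterate \<open>b\<^sup>n\<close>, and \<open>b\<^sup>n\<close> lies below the resource of
  every path with at most \<open>n\<close> arcs.  Deleting a cycle from a path does not increase its resource,
  so elementary paths suffice and \<open>b\<^sup>n \<le> b\<^sup>o\<^sup>p\<^sup>t\<close> as soon as \<open>n \<ge> \<ell>\<^sup>*\<close>.  For the same reason
  \<open>b\<^sup>o\<^sup>p\<^sup>t\<close> is a meet of finitely many resources; under distributivity it is therefore itself a
  solution of the system, hence below the greatest one, which closes the chain of inequalities.
\<close>

lemma path_resource_Nil [simp]: "path_resource x [] = 0"
  by (simp add: path_resource_def)

lemma path_resource_Cons [simp]: "path_resource x (a # p) = x a + path_resource x p"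
  by (simp add: path_resource_def)

lemma path_resource_append [simp]:
  "path_resource x (p @ q) = path_resource x p + path_resource x q"
  by (simp add: path_resource_def)

lemma path_resource_remove_cycle:
  fixes x :: "'e \<Rightarrow> 'r::lattice_ordered_monoid"
  assumes "0 \<le> path_resource x r"
  shows "path_resource x (q @ s) \<le> path_resource x (q @ r @ s)"
proof -
  have "0 + path_resource x s \<le> path_resource x r + path_resource x s"
    using assms by (rule add_isotone_right)
  from add_isotone_left[OF this] show ?thesis
    by simp
qed

lemma Fin_add_mono:
  fixes a :: "'r::lattice_ordered_monoid"
  assumes "b \<le> c"
  shows "Fin a + b \<le> Fin a + c"
  using assms by (cases b; cases c) (auto intro: add_isotone_left)

text \<open>Induction extends binary distributivity to finite meets only. This is why
  \<open>b_opt\<close> is first rewritten as a meet over elementary paths.\<close>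

lemma Fin_add_Inf_finite:
  fixes a :: "'r::{lattice_ordered_monoid, conditionally_complete_lattice}"
  assumes distrib: "\<And>b c :: 'r. a + inf b c = inf (a + b) (a + c)"
    and "finite S"
  shows "Fin a + Inf S = (INF s \<in> S. Fin a + s)"
  using \<open>finite S\<close>
proof induction
  case empty
  \<comment> \<open>The empty meet is \<open>Pinf\<close>, which absorbs the finite summand.\<close>
  then show ?case by (simp add: top_extended_def)
next
  case (insert s S)
  have "Fin a + inf s t = inf (Fin a + s) (Fin a + t)" for t
    by (cases s; cases t) (simp_all add: distrib)
  with insert show ?case by simp
qed

context wf_digraph
begin

text \<open>Covers the empty walk as well, which \<open>closed_w\<close> excludes.\<close>

lemma closed_awalk_resource_nonneg:
  fixes x :: "'b \<Rightarrow> 'r::lattice_ordered_monoid"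
  assumes "\<And>C. closed_w C \<Longrightarrow> 0 \<le> path_resource x C"
    and "awalk u p u"
  shows "0 \<le> path_resource x p"
proof (cases "p = []")
  case False
  with assms show ?thesis
    unfolding closed_w_def by blast
qed simp

text \<open>Closed subwalks are cut out one at a time until the walk is elementary; no cut increases
  the resource.\<close>

lemma apath_resource_le_awalk_resource:
  fixes x :: "'b \<Rightarrow> 'r::lattice_ordered_monoid"
  assumes nonneg: "\<And>C. closed_w C \<Longrightarrow> 0 \<le> path_resource x C"
    and "awalk u p v"
  obtains q where "apath u q v" "path_resource x q \<le> path_resource x p"
proof -
  have "\<exists>q. apath u q v \<and> path_resource x q \<le> path_resource x p"
    using \<open>awalk u p v\<close>
  proof (induction rule: awalk_to_apath_induct)
    case (path p)
    then show ?case by (auto simp: apath_def)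
  next
    case (decomp p q r s)
    then have "p = q @ r @ s" "closed_w r"
      by (auto elim: awalk_cyc_decompE)
    then have "path_resource x (q @ s) \<le> path_resource x p"
      using path_resource_remove_cycle nonneg by blast
    with decomp show ?case
      using order_trans by blast
  qed
  with that show thesis by blast
qed

text \<open>Induction on \<open>n\<close>, peeling off the first arc: the remaining walk has one arc
  less and is bounded by the previous iterate at \<open>head G a\<close>.\<close>

lemma b_iter_le_awalk_resource:
  fixes x :: "'b \<Rightarrow> 'r::{lattice_ordered_monoid, conditionally_complete_lattice}"
  assumes nonneg: "\<And>C. closed_w C \<Longrightarrow> 0 \<le> path_resource x C"
    and "awalk v p d" and "length p \<le> n"
  shows "b_iter G x d n v \<le> Fin (path_resource x p)"
  using assms(2,3)
proof (induction n arbitrary: v p)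
  case 0
  then have "v = d"
    by (auto simp: awalk_Nil_iff)
  with 0 show ?case
    by (auto simp: zero_extended_def)
next
  case (Suc n)
  consider "v = d" | "v \<noteq> d" "p = []" | a q where "v \<noteq> d" "p = a # q"
    by (cases p) auto
  then show ?case
  proof cases
    \<comment> \<open>The value at \<open>d\<close> is fixed to 0 instead of being a meet over arcs,
      so the recursion gives nothing here; but \<open>p\<close> is now closed, hence its resource is
      nonnegative.\<close>
    case 1
    then show ?thesis
      using closed_awalk_resource_nonneg[OF nonneg] Suc.prems(1) by (simp add: zero_extended_def)
  next
    case 2
    then show ?thesis
      using Suc.prems by (simp add: awalk_Nil_iff)
  next
    case (3 a q)
    then have a: "a \<in> out_arcs G v" and q: "awalk (head G a) q d" "length q \<le> n"
      using Suc.prems by (auto simp: awalk_Cons_iff)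
    have "b_iter G x d (Suc n) v \<le> arc_bound G x (b_iter G x d n) v"
      using 3 by simp
    also have "\<dots> \<le> Fin (x a) + b_iter G x d n (head G a)"
      unfolding arc_bound_def using a by (rule INF_lower)
    also have "\<dots> \<le> Fin (x a) + Fin (path_resource x q)"
      using Suc.IH[OF q] by (rule Fin_add_mono)
    finally show ?thesis
      using 3 by simp
  qed
qed

text \<open>The start \<open>b_iter G x d 0\<close> is the largest family with value 0 at
  \<open>d\<close>, and monotonicity of \<open>arc_bound\<close> carries the inequality from
  \<open>n\<close> to \<open>Suc n\<close>.\<close>

lemma bound_solution_le_b_iter:
  assumes "is_bound_solution G x d b" and "v \<in> verts G"
  shows "b v \<le> b_iter G x d n v"
  using assms(2)
proof (induction n arbitrary: v)
  case 0
  then show ?case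
    using assms(1) by (simp add: is_bound_solution_def)
next
  case (Suc n)
  show ?case
  proof (cases "v = d")
    case True
    then show ?thesis
      using assms(1) by (simp add: is_bound_solution_def)
  next
    case False
    then have "b v \<le> arc_bound G x b v"
      using assms(1) Suc.prems by (metis is_bound_solution_def inf.cobounded2 Diff_iff singletonD)
    also have "\<dots> \<le> arc_bound G x (b_iter G x d n) v"
      using wf_digraph_axioms Suc.IH by (rule arc_bound_mono)
    finally show ?thesis
      using False Suc by simp
  qed
qed

lemma b_opt_eq_Inf_apaths:
  fixes x :: "'b \<Rightarrow> 'r::{lattice_ordered_monoid, conditionally_complete_lattice}"
  assumes nonneg: "\<And>C. closed_w C \<Longrightarrow> 0 \<le> path_resource x C"
  shows "b_opt G x d v = (INF p \<in> {p. apath v p d}. Fin (path_resource x p))"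
  unfolding b_opt_def
proof (rule antisym)
  show "(INF p \<in> {p. awalk v p d}. Fin (path_resource x p))
      \<le> (INF p \<in> {p. apath v p d}. Fin (path_resource x p))"
    by (rule INF_superset_mono) (auto simp: apath_def)
  show "(INF p \<in> {p. apath v p d}. Fin (path_resource x p))
      \<le> (INF p \<in> {p. awalk v p d}. Fin (path_resource x p))"
  proof (rule INF_mono)
    fix p assume "p \<in> {p. awalk v p d}"
    then obtain q where "apath v q d" "path_resource x q \<le> path_resource x p"
      using apath_resource_le_awalk_resource[OF nonneg] by blast
    then show "\<exists>q \<in> {p. apath v p d}. Fin (path_resource x q) \<le> Fin (path_resource x p)"
      by auto
  qed
qed

end

context fin_digraph
begin

lemma b_iter_longest_le_b_opt:
  fixes x :: "'b \<Rightarrow> 'r::{lattice_ordered_monoid, conditionally_complete_lattice}"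
  assumes nonneg: "\<And>C. closed_w C \<Longrightarrow> 0 \<le> path_resource x C"
  shows "b_iter G x d (longest_elementary_length G v d) v \<le> b_opt G x d v"
proof (subst b_opt_eq_Inf_apaths)
  have "b_iter G x d (longest_elementary_length G v d) v \<le> Fin (path_resource x p)"
    if p: "apath v p d" for p
  proof -
    \<comment> \<open>The existence of \<open>p\<close> makes the set under \<open>Max\<close>
      nonempty. Without elementary paths \<open>Max\<close> is unspecified, but then the meet to be
      bounded is the top element.\<close>
    from p have "length p \<le> longest_elementary_length G v d"
      unfolding longest_elementary_length_def by (simp add: apaths_finite)
    with nonneg apath_def p show ?thesis
      by (blast intro: b_iter_le_awalk_resource)
  qed
  then show "b_iter G x d (longest_elementary_length G v d) v
      \<le> (INF p \<in> {p. apath v p d}. Fin (path_resource x p))"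
    by (blast intro: INF_greatest)
qed (rule nonneg)

lemma b_opt_is_bound_solution:
  fixes x :: "'b \<Rightarrow> 'r::{lattice_ordered_monoid, conditionally_complete_lattice}"
  assumes nonneg: "\<And>C. closed_w C \<Longrightarrow> 0 \<le> path_resource x C"
    and distrib: "\<And>a b c :: 'r. a + inf b c = inf (a + b) (a + c)"
    and "d \<in> verts G"
  shows "is_bound_solution G x d (b_opt G x d)"
  unfolding is_bound_solution_def
proof (intro conjI ballI)
  show "b_opt G x d d = 0"
  proof (rule antisym)
    have "b_opt G x d d \<le> Fin (path_resource x [])"
      unfolding b_opt_def using \<open>d \<in> verts G\<close> by (intro INF_lower) (simp add: awalk_Nil_iff)
    then show "b_opt G x d d \<le> 0"
      by (simp add: zero_extended_def)
    show "0 \<le> b_opt G x d d"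
      unfolding b_opt_def zero_extended_def
      using closed_awalk_resource_nonneg[OF nonneg] by (intro INF_greatest) simp
  qed
next
  fix v
  \<comment> \<open>The equation at \<open>v\<close> amounts to this inequality for every outgoing
    arc.\<close>
  have "b_opt G x d v \<le> Fin (x a) + b_opt G x d (head G a)" if a: "a \<in> out_arcs G v" for a
  proof -
    have "b_opt G x d v \<le> Fin (x a) + Fin (path_resource x p)" if "apath (head G a) p d" for p
    proof -
      \<comment> \<open>Prepending \<open>a\<close> may revisit a vertex, so \<open>a # p\<close> is
        compared with the meet over all walks, not just elementary ones.\<close>
      have "awalk v (a # p) d"
        using a that by (auto simp: awalk_Cons_iff apath_def)
      then have "b_opt G x d v \<le> Fin (path_resource x (a # p))"
        unfolding b_opt_def by (intro INF_lower) simp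
      then show ?thesis by simp
    qed
    then have "b_opt G x d v \<le> (INF p \<in> {p. apath (head G a) p d}. Fin (x a) + Fin (path_resource x p))"
      by (blast intro: INF_greatest)
    also have "\<dots> = Fin (x a) + (INF p \<in> {p. apath (head G a) p d}. Fin (path_resource x p))"
      by (simp add: Fin_add_Inf_finite[OF distrib] apaths_finite image_image)
    also have "\<dots> = Fin (x a) + b_opt G x d (head G a)"
      using b_opt_eq_Inf_apaths[where x = x] nonneg by simp
    finally show ?thesis .
  qed
  then show "b_opt G x d v = inf (b_opt G x d v) (arc_bound G x (b_opt G x d) v)"
    unfolding arc_bound_def by (intro inf_absorb1[symmetric] INF_greatest)
qed

end

theorem theorem9:
  fixes G :: "('v, 'e) pre_digraph"
    and d v :: 'v
    and x :: "'e \<Rightarrow> 'r::{lattice_ordered_monoid, conditionally_complete_lattice}"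
    and P :: "'e awalk"
  assumes "fin_digraph G"
    and "d \<in> verts G"
    and "\<And>C. wf_digraph.closed_w G C \<Longrightarrow> path_resource x C \<ge> 0"
    and "v \<in> verts G"
    and "pre_digraph.awalk G v P d"
  shows "(b_dagger G x d v \<le> b_infty G x d v \<and>
          b_infty G x d v \<le> b_iter G x d (longest_elementary_length G v d) v \<and>
          b_iter G x d (longest_elementary_length G v d) v \<le> b_opt G x d v \<and>
          b_opt G x d v \<le> Fin (path_resource x P)) \<and>
         ((\<forall>a b c :: 'r. a + inf b c = inf (a + b) (a + c) \<and> inf a b + c = inf (a + c) (b + c)) \<longrightarrow>
          b_dagger G x d v = b_infty G x d v \<and>
          b_infty G x d v = b_iter G x d (longest_elementary_length G v d) v \<and>
          b_iter G x d (longest_elementary_length G v d) v = b_opt G x d v)"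
proof -
  interpret fin_digraph G by fact
  note nonneg = assms(3)
  have dagger: "b_dagger G x d v \<le> b_infty G x d v"
    unfolding b_infty_def
    using bound_solution_le_b_iter[OF b_dagger_greatest(1)] assms(1,2,4)
    by (blast intro: INF_greatest)
  have infty: "b_infty G x d v \<le> b_iter G x d (longest_elementary_length G v d) v"
    unfolding b_infty_def by (rule INF_lower) simp
  have iter: "b_iter G x d (longest_elementary_length G v d) v \<le> b_opt G x d v"
    using nonneg by (rule b_iter_longest_le_b_opt)
  have opt: "b_opt G x d v \<le> Fin (path_resource x P)"
    unfolding b_opt_def using assms(5) by (intro INF_lower) simp
  have "b_opt G x d v \<le> b_dagger G x d v"
    if "\<forall>a b c :: 'r. a + inf b c = inf (a + b) (a + c) \<and> inf a b + c = inf (a + c) (b + c)"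
  proof (rule b_dagger_greatest(2)[OF assms(1,2)])
    show "is_bound_solution G x d (b_opt G x d)"
      using nonneg that assms(2) by (intro b_opt_is_bound_solution) auto
  qed fact
  with dagger infty iter opt show ?thesis
    by (meson antisym order_trans)
qed

end
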